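(* For every integer $i\ge0$ and all $t\ne0$, $$\biggl(\frac1{e^t-1}\biggr)^{(i)}=\sum_{m=1}^{i+1}\frac{\lambda_{i,m}}{(e^t-1)^m},$$ where $\lambda_{i,m}=(-1)^i(m-1)!\,S(i+1,m)$ for $1\le m\le i+1$.
   Context: $t$ is a real variable. For a function $f$ of $t$, $f^{(n)}$ denotes the $n$-th derivative with respect to $t$, with $f^{(0)}=f$. For $1\le m\le n$, $S(n,m)=\frac1{m!}\sum_{\ell=0}^m(-1)^{m-\ell}\binom{m}{\ell}\ell^{n}$ are the Stirling numbers of the second kind. *)

theory Defs
  imports "HOL-Analysis.Analysis" "HOL-Combinatorics.Stirling"
begin

definition stirling2 :: "nat \<Rightarrow> nat \<Rightarrow> real" where
  "stirling2 n m =
     1 / fact m * (\<Sum>l=0..m. (-1) ^ (m - l) * real (m choose l) * real l ^ n)"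

lemma stirling2_eq_Stirling: "stirling2 n m = real (Stirling n m)"
proof -
  define a :: "nat \<Rightarrow> nat \<Rightarrow> real" where
    "a = (\<lambda>n m. \<Sum>l=0..m. (-1) ^ (m - l) * real (m choose l) * real l ^ n)"
  have rec: "a (Suc n) (Suc m) = real (Suc m) * (a n (Suc m) + a n m)" for n m
  proof -
    have absorb: "(real (Suc m) - real l) * real (Suc m choose l) = real (Suc m) * real (m choose l)"
      if "l \<le> Suc m" for l
    proof -
      have "real ((Suc m - l) * (Suc m choose l)) = real (Suc m * (m choose l))"
        using binomial_absorb_comp[of "Suc m" l] by (metis diff_Suc_1)
      with that show ?thesis by (simp only: of_nat_mult of_nat_diff)
    qed
    have ext: "a n m = (\<Sum>l=0..Suc m. (-1) ^ (m - l) * real (m choose l) * real l ^ n)"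
      by (simp add: a_def)
    have summand: "(-1) ^ (Suc m - l) * real (Suc m choose l) * real l ^ Suc n
       = real (Suc m) * ((-1) ^ (Suc m - l) * real (Suc m choose l) * real l ^ n
           + (-1) ^ (m - l) * real (m choose l) * real l ^ n)" if "l \<le> Suc m" for l
    proof (cases "l = Suc m")
      case True
      then show ?thesis by simp
    next
      case False
      with that have s: "(-1 :: real) ^ (Suc m - l) = - ((-1) ^ (m - l))"
        by (simp add: Suc_diff_le)
      define c where "c = real (Suc m choose l)"
      define d where "d = real (m choose l)"
      define M where "M = real (Suc m)"
      have e: "M * d = (M - real l) * c" using absorb[OF that] by (simp add: c_def d_def M_def)
      have "M * (- ((-1) ^ (m - l)) * c * real l ^ n + (-1) ^ (m - l) * d * real l ^ n)
          = (-1) ^ (m - l) * real l ^ n * (M * d - M * c)"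
        by (simp add: algebra_simps)
      also have "\<dots> = - ((-1) ^ (m - l)) * c * real l ^ Suc n"
        unfolding e by (simp add: algebra_simps)
      finally show ?thesis unfolding s c_def d_def M_def by (rule sym)
    qed
    show ?thesis
      unfolding ext unfolding a_def sum.distrib[symmetric] sum_distrib_left
      by (rule sum.cong[OF refl]) (rule summand, simp)
  qed
  have zero: "a 0 m = (if m = 0 then 1 else 0)" for m
  proof -
    have "a 0 m = (\<Sum>l\<le>m. real (m choose l) * 1 ^ l * (-1) ^ (m - l))"
      by (simp add: a_def atLeast0AtMost mult.commute)
    also have "\<dots> = (1 + (-1)) ^ m"
      by (rule binomial_ring[symmetric])
    finally show ?thesis by simp
  qed
  have "a n m = fact m * real (Stirling n m)"
  proof (induction n arbitrary: m)
    case 0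
    then show ?case by (cases m) (auto simp: zero)
  next
    case (Suc n)
    show ?case
    proof (cases m)
      case 0
      then show ?thesis by (simp add: a_def)
    next
      case (Suc k)
      show ?thesis unfolding Suc rec Suc.IH by (simp add: algebra_simps)
    qed
  qed
  then show ?thesis by (simp add: stirling2_def a_def)
qed

definition lam :: "nat \<Rightarrow> nat \<Rightarrow> real" where
  "lam i m = (-1) ^ i * fact (m - 1) * stirling2 (i + 1) m"

end

theory Submission
  imports Defs
begin

text \<open>The function \<open>u(x) = 1 / (exp x - 1)\<close> solves the Riccati equation \<open>u' = - (u + u\<^sup>2)\<close>, so
  \<open>(u ^ m)' = - m * (u ^ m + u ^ (m + 1))\<close>.  Hence differentiating a linear combination of powers of
  \<open>u\<close> gives another one, with one more term, and the coefficient of \<open>u ^ m\<close> in the result is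
  \<open>- (m * c m + (m - 1) * c (m - 1))\<close>, where \<open>c\<close> are the old coefficients.  After
  multiplying the recurrence \<open>S(n + 1, m) = m * S(n, m) + S(n, m - 1)\<close> by \<open>\<plusminus> (m - 1)!\<close> one sees
  that the numbers \<open>lam i m\<close> satisfy this same rule (\<open>lam_Suc\<close>), and the formula
  follows by induction on the number of derivatives.\<close>

lemma lam_0_1: "lam 0 (Suc 0) = 1"
  by (simp add: lam_def stirling2_eq_Stirling)

lemma lam_eq_0: "m > Suc i \<Longrightarrow> lam i m = 0"
  by (simp add: lam_def stirling2_eq_Stirling)

text \<open>This is the recurrence for \<open>S(i + 2, m + 1)\<close> times \<open>m!\<close>: the factor \<open>m\<close> in the last summand
  turns \<open>(m - 1)!\<close> into \<open>m!\<close>, and for \<open>m = 0\<close> it produces the value \<open>S(i + 1, 0) = 0\<close>.\<close>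

lemma lam_Suc: "lam (Suc i) (Suc m) = - (real (Suc m) * lam i (Suc m) + real m * lam i m)"
  by (cases m) (simp_all add: lam_def stirling2_eq_Stirling algebra_simps)

text \<open>This is the power rule combined with the Riccati equation; the latter is the identity
  \<open>exp x = (exp x - 1) + 1\<close> divided by \<open>- ((exp x - 1)\<^sup>2)\<close>.\<close>

lemma has_real_derivative_inverse_exp_minus_one_power:
  assumes "x \<noteq> 0"
  shows "((\<lambda>x::real. 1 / (exp x - 1) ^ Suc m) has_real_derivative
           - (real (Suc m) * (1 / (exp x - 1) ^ Suc m + 1 / (exp x - 1) ^ Suc (Suc m)))) (at x)"
proof -
  define y where "y = exp x - 1"
  have y: "y \<noteq> 0" and e: "exp x = y + 1"
    using assms by (simp_all add: y_def)
  show ?thesis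
    by (rule derivative_eq_intros refl)+
      (use y in \<open>simp_all add: e field_simps\<close>)
qed

text \<open>Induction over \<open>i\<close> has to differentiate the formula for \<open>i\<close>, which is legitimate because
  that formula holds on the whole open set \<open>- {0}\<close>.\<close>

theorem lemma2p1:
  fixes i :: nat and t :: real
  assumes "t \<noteq> 0"
  shows "(deriv ^^ i) (\<lambda>x::real. 1 / (exp x - 1)) t
           = (\<Sum>m=1..i+1. lam i m / (exp t - 1) ^ m)"
  using assms
proof (induction i arbitrary: t)
  case 0
  then show ?case by (simp add: lam_0_1)
next
  case (Suc i)
  let ?f = "(deriv ^^ i) (\<lambda>x::real. 1 / (exp x - 1))"
  define p where "p m = 1 / (exp t - 1) ^ m" for m
  have formula: "?f x = (\<Sum>m\<le>i. lam i (Suc m) * (1 / (exp x - 1) ^ Suc m))" if "x \<noteq> 0" for x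
    using Suc.IH[OF that]
    by (simp add: sum.shift_bounds_cl_Suc_ivl atLeast0AtMost del: power_Suc sum.cl_ivl_Suc)
  have "((\<lambda>x. \<Sum>m\<le>i. lam i (Suc m) * (1 / (exp x - 1) ^ Suc m)) has_real_derivative
          (\<Sum>m\<le>i. lam i (Suc m) * - (real (Suc m) * (p (Suc m) + p (Suc (Suc m)))))) (at t)"
    unfolding p_def
    by (intro DERIV_sum DERIV_cmult has_real_derivative_inverse_exp_minus_one_power Suc.prems)
  then have "(?f has_real_derivative
          (\<Sum>m\<le>i. lam i (Suc m) * - (real (Suc m) * (p (Suc m) + p (Suc (Suc m)))))) (at t)"
    by (rule has_field_derivative_transform_within_open[where S = "- {0}"])
      (use Suc.prems formula in auto)
  then have "deriv ?f t =
      (\<Sum>m\<le>i. lam i (Suc m) * - (real (Suc m) * (p (Suc m) + p (Suc (Suc m)))))"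
    by (rule DERIV_imp_deriv)
  also have "\<dots> = - ((\<Sum>m\<le>i. real (Suc m) * lam i (Suc m) * p (Suc m))
                  + (\<Sum>m\<le>i. real (Suc m) * lam i (Suc m) * p (Suc (Suc m))))"
    unfolding sum.distrib[symmetric] sum_negf[symmetric]
    by (rule sum.cong) (simp_all add: algebra_simps)
  \<comment> \<open>Both sums may range over \<open>m \<le> Suc i\<close>: the first gains a vanishing last term, the second,
      after an index shift, a vanishing first term.\<close>
  also have "(\<Sum>m\<le>i. real (Suc m) * lam i (Suc m) * p (Suc m))
      = (\<Sum>m\<le>Suc i. real (Suc m) * lam i (Suc m) * p (Suc m))"
    by (simp add: lam_eq_0)
  also have "(\<Sum>m\<le>i. real (Suc m) * lam i (Suc m) * p (Suc (Suc m)))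
      = (\<Sum>m\<le>Suc i. real m * lam i m * p (Suc m))"
    by (subst sum.atMost_Suc_shift) simp
  also have "- ((\<Sum>m\<le>Suc i. real (Suc m) * lam i (Suc m) * p (Suc m))
                  + (\<Sum>m\<le>Suc i. real m * lam i m * p (Suc m)))
      = (\<Sum>m\<le>Suc i. lam (Suc i) (Suc m) * p (Suc m))"
    unfolding sum.distrib[symmetric] sum_negf[symmetric] lam_Suc
    by (rule sum.cong) (simp_all add: algebra_simps)
  also have "\<dots> = (\<Sum>m=1..Suc i + 1. lam (Suc i) m / (exp t - 1) ^ m)"
    by (simp add: p_def sum.shift_bounds_cl_Suc_ivl atLeast0AtMost
        del: power_Suc sum.cl_ivl_Suc sum.atMost_Suc)
  finally show ?case by simp
qed

end
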